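(* (i) For every odd $k$, the optimal deterministic competitive ratio for One-out-of-$m$ Paging with $k$ slots and $m=(k+1)/2$ is at least $\binom{k}{m}=\Omega(2^k/\sqrt{k})$. For every $k$, the optimal deterministic competitive ratio for One-out-of-$m$ Paging with $k$ slots and $m=\lfloor (k+1)/2\rfloor$ is $\Omega(2^k/\sqrt{k})$. (ii) For every even $m\ge 2$ and every $k>m$ that is an odd multiple of $m-1$, the optimal deterministic competitive ratio for One-out-of-$m$ Paging with $k$ slots is at least $\binom{m-1}{m/2}\left(\frac{k}{m-1}\right)^{m/2}=\Theta\big((4k/m)^{m/2}/\sqrt{m}\big)=\Omega\big(\sqrt{|\mathcal{F}|}\big)$, where $\mathcal{F}=\binom{[k]}{m}$.
   Context: Slot-Heterogenous Paging: cache slots $[k]$, a family $\mathcal{F}\subseteq 2^{[k]}\setminus\{\emptyset\}$ of requestable slot sets, and requests $(p,S)$ with $p$ a page and $S\in\mathcal{F}$. A configuration assigns to each slot a single page or nothing and satisfies $(p,S)$ if some slot in $S$ holds $p$. A solution is a sequence of configurations $C_1,\dots,C_T$ with $C_t$ satisfying the $t$-th request; its cost is the number of retrievals (page $p$ is retrieved in slot $s$ at time $t$ if $C_t$ assigns $p$ to $s$ but $C_{t-1}$ does not, or $t=1$). A deterministic online algorithm is $c$-competitive if its cost is at most $c\cdot\mathrm{OPT}(\sigma)+b$ for every request sequence $\sigma$, for a constant $b$ independent of $\sigma$; the optimal deterministic competitive ratio is the infimum of such $c$ over deterministic online algorithms. One-out-of-$m$ Paging is Slot-Heterogenous Paging with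 $\mathcal{F}=\binom{[k]}{m}=\{S\subseteq[k]: |S|=m\}$. *)

theory Defs
  imports Complex_Main "HOL-Library.Extended_Real" "HOL-Library.Landau_Symbols"
begin

text \<open>The cache slots are \<open>{1..k}\<close>. Pages come from an infinite universe, represented by the
  natural numbers.\<close>

type_synonym slot = nat
type_synonym page = nat
type_synonym request = "page \<times> slot set"
type_synonym config = "slot \<rightharpoonup> page"

definition is_config :: "nat \<Rightarrow> config \<Rightarrow> bool" where
  "is_config k C \<longleftrightarrow> dom C \<subseteq> {1..k}"

definition satisfies :: "config \<Rightarrow> request \<Rightarrow> bool" where
  "satisfies C r \<longleftrightarrow> (\<exists>s\<in>snd r. C s = Some (fst r))"

definition request_seqs :: "slot set set \<Rightarrow> request list set" where
  "request_seqs F = {\<sigma>. \<forall>r\<in>set \<sigma>. snd r \<in> F}"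

definition is_solution :: "nat \<Rightarrow> request list \<Rightarrow> config list \<Rightarrow> bool" where
  "is_solution k \<sigma> Cs \<longleftrightarrow> length Cs = length \<sigma> \<and>
     (\<forall>t<length \<sigma>. is_config k (Cs ! t) \<and> satisfies (Cs ! t) (\<sigma> ! t))"

text \<open>Time is 0-based here: index \<open>t\<close> is the time step \<open>t + 1\<close>.\<close>

definition retrievals :: "config list \<Rightarrow> nat \<Rightarrow> (page \<times> slot) set" where
  "retrievals Cs t =
     {(p, s). (Cs ! t) s = Some p \<and> (t = 0 \<or> (Cs ! (t - 1)) s \<noteq> Some p)}"

definition cost :: "config list \<Rightarrow> nat" where
  "cost Cs = (\<Sum>t<length Cs. card (retrievals Cs t))"

definition OPT :: "nat \<Rightarrow> request list \<Rightarrow> nat" where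
  "OPT k \<sigma> = Inf {cost Cs | Cs. is_solution k \<sigma> Cs}"

text \<open>A deterministic online algorithm maps the requests seen so far to the current
  configuration.\<close>

type_synonym algorithm = "request list \<Rightarrow> config"

definition run :: "algorithm \<Rightarrow> request list \<Rightarrow> config list" where
  "run A \<sigma> = map (\<lambda>t. A (take (Suc t) \<sigma>)) [0..<length \<sigma>]"

definition online_algorithm :: "nat \<Rightarrow> slot set set \<Rightarrow> algorithm \<Rightarrow> bool" where
  "online_algorithm k F A \<longleftrightarrow> (\<forall>\<sigma>\<in>request_seqs F. is_solution k \<sigma> (run A \<sigma>))"

definition competitive :: "nat \<Rightarrow> slot set set \<Rightarrow> real \<Rightarrow> algorithm \<Rightarrow> bool" where
  "competitive k F c A \<longleftrightarrow>
     (\<exists>b::real. \<forall>\<sigma>\<in>request_seqs F. real (cost (run A \<sigma>)) \<le> c * real (OPT k \<sigma>) + b)"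

text \<open>The infimum is taken in the extended reals, so that it would be \<open>\<infinity>\<close> (rather than
  unspecified) if no algorithm were competitive.\<close>

definition det_ratio :: "nat \<Rightarrow> slot set set \<Rightarrow> ereal" where
  "det_ratio k F = Inf {ereal c | c. \<exists>A. online_algorithm k F A \<and> competitive k F c A}"

definition one_out_of :: "nat \<Rightarrow> nat \<Rightarrow> slot set set" where
  "one_out_of m k = {S. S \<subseteq> {1..k} \<and> card S = m}"

definition admissible :: "(nat \<times> nat) set" where
  "admissible = {(m, k). even m \<and> 2 \<le> m \<and> m < k \<and> (\<exists>j. odd j \<and> k = j * (m - 1))}"

end

theory Submission
  imports Defs "HOL-Library.FuncSet"
begin

text \<open>
  A finite set \<open>Q\<close> of requests that is unsatisfiable by a single configuration, but minimal with
  this property, forces a ratio of at least \<open>|Q| / 2\<close>: the adversary always requests an element of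
  \<open>Q\<close> violated by the current configuration, so that each of the \<open>T\<close> requests costs at least 1.
  Offline, one can stay in a configuration that satisfies \<open>Q - {q}\<close>, changing one slot and changing
  it back whenever \<open>q\<close> is requested. This costs 2 per occurrence of \<open>q\<close>, and averaging over \<open>q\<close>
  bounds the optimum by \<open>k + 2 T / |Q|\<close>.

  With two pages, configurations are 2-colourings of the slots, and a hypergraph \<open>Z\<close> that is
  critically non-2-colourable yields a minimal unsatisfiable set of \<open>2 |Z|\<close> requests. For (i), \<open>Z\<close>
  consists of the \<open>m\<close>-subsets of \<open>2 m - 1\<close> slots. For (ii), \<open>Z\<close> arises from the \<open>m / 2\<close>-subsets of
  \<open>m - 1\<close> points by blowing up each point to an odd cycle: an edge of \<open>Z\<close> is a union of edges, one
  from each of \<open>m / 2\<close> cycles.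
\<close>

section \<open>Retrieval costs\<close>

definition fetched :: "config \<Rightarrow> config \<Rightarrow> (page \<times> slot) set" where
  "fetched C C' = {(p, s). C' s = Some p \<and> C s \<noteq> Some p}"

definition last_config :: "config list \<Rightarrow> config" where
  "last_config Cs = last (Map.empty # Cs)"

lemma last_config_Nil [simp]: "last_config [] = Map.empty"
  by (simp add: last_config_def)

lemma last_config_snoc [simp]: "last_config (Cs @ [C]) = C"
  by (simp add: last_config_def)

lemma cost_Nil [simp]: "cost [] = 0"
  by (simp add: cost_def)

lemma cost_snoc: "cost (Cs @ [C]) = cost Cs + card (fetched (last_config Cs) C)"
proof -
  have "retrievals (Cs @ [C]) t = retrievals Cs t" if "t < length Cs" for t
    using that by (simp add: retrievals_def nth_append less_imp_diff_less)
  moreover have "retrievals (Cs @ [C]) (length Cs) = fetched (last_config Cs) C"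
    by (cases Cs rule: rev_cases) (auto simp: retrievals_def fetched_def nth_append)
  ultimately show ?thesis
    by (simp add: cost_def)
qed

lemma
  assumes "is_config k C'"
  shows finite_fetched: "finite (fetched C C')"
    and card_fetched_le: "card (fetched C C') \<le> k"
proof -
  have sub: "fetched C C' \<subseteq> (\<lambda>s. (the (C' s), s)) ` {1..k}"
    using assms by (force simp: fetched_def is_config_def)
  show "finite (fetched C C')"
    using finite_subset[OF sub] by simp
  show "card (fetched C C') \<le> k"
    using order_trans[OF card_mono[OF _ sub] card_image_le] by simp
qed

lemma fetched_same [simp]: "fetched C C = {}"
  by (simp add: fetched_def)

lemma card_fetched_le_1:
  assumes "\<And>s'. s' \<noteq> s \<Longrightarrow> C' s' = C s'"
  shows "card (fetched C C') \<le> 1"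
proof -
  have "s' = s" if "(p, s') \<in> fetched C C'" for p s'
    using assms[of s'] that by (cases "s' = s") (auto simp: fetched_def)
  then have "fetched C C' \<subseteq> {(the (C' s), s)}"
    by (auto simp: fetched_def)
  from card_mono[OF _ this] show ?thesis
    by simp
qed

lemma card_fetched_pos:
  assumes "is_config k C'" "satisfies C' r" "\<not> satisfies C r"
  shows "0 < card (fetched C C')"
proof -
  obtain s where "s \<in> snd r" "C' s = Some (fst r)"
    using assms(2) by (auto simp: satisfies_def)
  then have "(fst r, s) \<in> fetched C C'"
    using assms(3) by (auto simp: fetched_def satisfies_def)
  then show ?thesis
    using finite_fetched[OF assms(1)] by (auto simp: card_gt_0_iff)
qed

lemma run_Nil [simp]: "run A [] = []"
  by (simp add: run_def)

lemma run_snoc [simp]: "run A (\<sigma> @ [r]) = run A \<sigma> @ [A (\<sigma> @ [r])]"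
  by (simp add: run_def)

lemma OPT_le_cost: "is_solution k \<sigma> Cs \<Longrightarrow> OPT k \<sigma> \<le> cost Cs"
  unfolding OPT_def by (rule cInf_lower) auto

section \<open>Minimal unsatisfiable sets of requests\<close>

definition satisfiable :: "nat \<Rightarrow> request set \<Rightarrow> bool" where
  "satisfiable k Q \<longleftrightarrow> (\<exists>C. is_config k C \<and> (\<forall>r\<in>Q. satisfies C r))"

definition minimal_unsatisfiable :: "nat \<Rightarrow> request set \<Rightarrow> bool" where
  "minimal_unsatisfiable k Q \<longleftrightarrow> \<not> satisfiable k Q \<and> (\<forall>q\<in>Q. satisfiable k (Q - {q}))"

lemma online_algorithm_snocD:
  assumes "online_algorithm k F A" "\<sigma> @ [r] \<in> request_seqs F"
  shows "is_config k (A (\<sigma> @ [r]))" and "satisfies (A (\<sigma> @ [r])) r"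
proof -
  have sol: "is_solution k (\<sigma> @ [r]) (run A \<sigma> @ [A (\<sigma> @ [r])])"
    using assms by (simp add: online_algorithm_def flip: run_snoc)
  have "length (run A \<sigma>) = length \<sigma>"
    by (simp add: run_def)
  then show "is_config k (A (\<sigma> @ [r]))" "satisfies (A (\<sigma> @ [r])) r"
    using sol by (auto simp: is_solution_def nth_append dest!: spec[of _ "length \<sigma>"])
qed

lemma online_algorithm_slots:
  assumes "online_algorithm k F A" "S \<in> F"
  shows "S \<inter> {1..k} \<noteq> {}"
proof -
  have "[(p, S)] \<in> request_seqs F" for p
    using assms(2) by (simp add: request_seqs_def)
  then have "is_config k (A [(p, S)])" "satisfies (A [(p, S)]) (p, S)" for p
    using online_algorithm_snocD[OF assms(1), of "[]"] by simp_all
  then show ?thesis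
    by (fastforce simp: is_config_def satisfies_def)
qed

lemma ex_costly_requests:
  assumes alg: "online_algorithm k F A" and F: "snd ` Q \<subseteq> F" and unsat: "\<not> satisfiable k Q"
  shows "\<exists>\<sigma>. set \<sigma> \<subseteq> Q \<and> length \<sigma> = n \<and> n \<le> cost (run A \<sigma>)"
proof -
  have "\<exists>\<sigma>. set \<sigma> \<subseteq> Q \<and> length \<sigma> = n \<and> n \<le> cost (run A \<sigma>) \<and> is_config k (last_config (run A \<sigma>))"
  proof (induction n)
    case 0
    show ?case
      by (rule exI[of _ "[]"]) (simp add: is_config_def)
  next
    case (Suc n)
    then obtain \<sigma> where \<sigma>: "set \<sigma> \<subseteq> Q" "length \<sigma> = n" "n \<le> cost (run A \<sigma>)"
      "is_config k (last_config (run A \<sigma>))"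
      by blast
    then obtain r where r: "r \<in> Q" "\<not> satisfies (last_config (run A \<sigma>)) r"
      using unsat by (auto simp: satisfiable_def)
    have "\<sigma> @ [r] \<in> request_seqs F"
      using F \<sigma>(1) r(1) by (auto simp: request_seqs_def)
    note next_config = online_algorithm_snocD[OF alg this]
    have "Suc n \<le> cost (run A (\<sigma> @ [r]))"
      using card_fetched_pos[OF next_config r(2)] \<sigma>(3) by (simp add: cost_snoc)
    then show ?case
      using \<sigma> r(1) next_config(1) by (intro exI[of _ "\<sigma> @ [r]"]) simp
  qed
  then show ?thesis
    by blast
qed

lemma cost_detour_le:
  assumes "is_config k C" "s \<in> {1..k}"
  shows "cost (map (\<lambda>r. if r = q then C(s \<mapsto> p) else C) \<sigma>) \<le> k + 2 * count_list \<sigma> q"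
proof -
  let ?Cs = "map (\<lambda>r. if r = q then C(s \<mapsto> p) else C)"
  have conf: "is_config k (C(s \<mapsto> p))"
    using assms by (auto simp: is_config_def)
  have change: "card (fetched (C(s \<mapsto> p)) C) \<le> 1" "card (fetched C (C(s \<mapsto> p))) \<le> 1"
    by (rule card_fetched_le_1[of s]; simp)+
  \<comment> \<open>A detour at the last request still has to be undone.\<close>
  have "cost (?Cs \<sigma>) + of_bool (\<sigma> \<noteq> [] \<and> last \<sigma> = q) \<le> k + 2 * count_list \<sigma> q"
  proof (induction \<sigma> rule: rev_induct)
    case (snoc r \<sigma>)
    show ?case
    proof (cases "\<sigma> = []")
      case True
      then show ?thesis
        using card_fetched_le[OF assms(1)] card_fetched_le[OF conf] cost_snoc[of "[]"]
        by (simp add: le_SucI)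
    next
      case False
      then have "last_config (?Cs \<sigma>) = (if last \<sigma> = q then C(s \<mapsto> p) else C)"
        by (simp add: last_config_def last_map)
      then show ?thesis
        using snoc.IH change False by (auto simp: cost_snoc split: if_splits)
    qed
  qed simp
  then show ?thesis
    by linarith
qed

lemma OPT_le_count_list:
  assumes "satisfiable k (Q - {q})" "snd q \<inter> {1..k} \<noteq> {}" "set \<sigma> \<subseteq> Q"
  shows "OPT k \<sigma> \<le> k + 2 * count_list \<sigma> q"
proof -
  obtain C where C: "is_config k C" "\<And>r. r \<in> Q \<Longrightarrow> r \<noteq> q \<Longrightarrow> satisfies C r"
    using assms(1) by (auto simp: satisfiable_def)
  obtain s where s: "s \<in> snd q" "s \<in> {1..k}"
    using assms(2) by blast
  let ?D = "C(s \<mapsto> fst q)"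
  have "is_config k ?D" "satisfies ?D q"
    using C(1) s by (auto simp: is_config_def satisfies_def)
  moreover have "\<sigma> ! t \<in> Q" if "t < length \<sigma>" for t
    using assms(3) that by auto
  ultimately have "is_solution k \<sigma> (map (\<lambda>r. if r = q then ?D else C) \<sigma>)"
    using C by (auto simp: is_solution_def)
  then have "OPT k \<sigma> \<le> cost (map (\<lambda>r. if r = q then ?D else C) \<sigma>)"
    by (rule OPT_le_cost)
  also have "\<dots> \<le> k + 2 * count_list \<sigma> q"
    using C(1) s(2) by (rule cost_detour_le)
  finally show ?thesis .
qed

lemma card_mult_OPT_le:
  assumes "finite Q" "set \<sigma> \<subseteq> Q"
    and "\<And>q. q \<in> Q \<Longrightarrow> satisfiable k (Q - {q})" "\<And>q. q \<in> Q \<Longrightarrow> snd q \<inter> {1..k} \<noteq> {}"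
  shows "card Q * OPT k \<sigma> \<le> card Q * k + 2 * length \<sigma>"
proof -
  have "card Q * OPT k \<sigma> = (\<Sum>q\<in>Q. OPT k \<sigma>)"
    by simp
  also have "\<dots> \<le> (\<Sum>q\<in>Q. k + 2 * count_list \<sigma> q)"
    using assms by (intro sum_mono OPT_le_count_list)
  also have "\<dots> = card Q * k + 2 * length \<sigma>"
    using assms by (simp add: sum.distrib sum_count_set flip: sum_distrib_left)
  finally show ?thesis .
qed

lemma le_of_linear_bound:
  fixes a c d :: real
  assumes "\<And>n. a * real n \<le> c * real n + d"
  shows "a \<le> c"
proof (rule ccontr)
  assume "\<not> a \<le> c"
  then obtain n where "d < real n * (a - c)"
    using reals_Archimedean3[of "a - c"] by auto
  then show False
    using assms[of n] by (simp add: algebra_simps)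
qed

lemma competitive_ratio_ge:
  fixes a c r :: real
  assumes comp: "competitive k F c A" and r: "0 < r"
    and costly: "\<And>n. \<exists>\<sigma>\<in>request_seqs F. n \<le> cost (run A \<sigma>) \<and> r * real (OPT k \<sigma>) \<le> a + real n"
  shows "r \<le> c"
proof -
  obtain b where b: "\<And>\<sigma>. \<sigma> \<in> request_seqs F \<Longrightarrow> real (cost (run A \<sigma>)) \<le> c * real (OPT k \<sigma>) + b"
    using comp by (auto simp: competitive_def)
  \<comment> \<open>Nothing forces \<open>c\<close> to be nonnegative, but \<open>max 0 c\<close> is a competitive ratio of \<open>A\<close> too.\<close>
  define c' where "c' = max 0 c"
  have "r * real n \<le> c' * real n + (c' * a + r * b)" for n
  proof -
    obtain \<sigma> where \<sigma>: "\<sigma> \<in> request_seqs F" "n \<le> cost (run A \<sigma>)" "r * real (OPT k \<sigma>) \<le> a + real n"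
      using costly by blast
    have "real n \<le> c * real (OPT k \<sigma>) + b"
      using b[OF \<sigma>(1)] \<sigma>(2) by linarith
    also have "\<dots> \<le> c' * real (OPT k \<sigma>) + b"
      by (simp add: c'_def mult_right_mono)
    finally have "r * real n \<le> r * (c' * real (OPT k \<sigma>) + b)"
      using r by (intro mult_left_mono) auto
    also have "\<dots> = c' * (r * real (OPT k \<sigma>)) + r * b"
      by (simp add: algebra_simps)
    also have "\<dots> \<le> c' * (a + real n) + r * b"
      using \<sigma>(3) by (intro add_right_mono mult_left_mono) (auto simp: c'_def)
    finally show ?thesis
      by (simp add: algebra_simps)
  qed
  then have "r \<le> c'"
    by (rule le_of_linear_bound)
  then show ?thesis
    using r by (simp add: c'_def max_def split: if_splits)
qed

lemma minimal_unsatisfiable_nonempty: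
  assumes "minimal_unsatisfiable k Q"
  shows "Q \<noteq> {}"
proof -
  have "satisfiable k {}"
    unfolding satisfiable_def by (rule exI[of _ Map.empty]) (simp add: is_config_def)
  then show ?thesis
    using assms by (auto simp: minimal_unsatisfiable_def)
qed

theorem card_minimal_unsatisfiable_le_det_ratio:
  assumes "finite Q" "snd ` Q \<subseteq> F" "minimal_unsatisfiable k Q"
  shows "ereal (real (card Q) / 2) \<le> det_ratio k F"
  unfolding det_ratio_def
proof (rule Inf_greatest)
  fix x assume "x \<in> {ereal c |c. \<exists>A. online_algorithm k F A \<and> competitive k F c A}"
  then obtain c A where x: "x = ereal c"
    and alg: "online_algorithm k F A" and comp: "competitive k F c A"
    by blast
  have minimal: "\<not> satisfiable k Q" "\<And>q. q \<in> Q \<Longrightarrow> satisfiable k (Q - {q})"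
    using assms(3) by (auto simp: minimal_unsatisfiable_def)
  have slots: "snd q \<inter> {1..k} \<noteq> {}" if "q \<in> Q" for q
    using online_algorithm_slots[OF alg, of "snd q"] assms(2) that by blast
  have "real (card Q) / 2 \<le> c"
  proof (rule competitive_ratio_ge[OF comp])
    show "0 < real (card Q) / 2"
      using assms(1) minimal_unsatisfiable_nonempty[OF assms(3)] by (simp add: card_gt_0_iff)
    fix n
    obtain \<sigma> where \<sigma>: "set \<sigma> \<subseteq> Q" "length \<sigma> = n" "n \<le> cost (run A \<sigma>)"
      using ex_costly_requests[OF alg assms(2) minimal(1)] by blast
    have "real (card Q * OPT k \<sigma>) \<le> real (card Q * k + 2 * n)"
      using card_mult_OPT_le[OF assms(1) \<sigma>(1) minimal(2) slots] \<sigma>(2) by (intro of_nat_mono) simp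
    moreover have "\<sigma> \<in> request_seqs F"
      using assms(2) \<sigma>(1) by (auto simp: request_seqs_def)
    ultimately show "\<exists>\<sigma>\<in>request_seqs F. n \<le> cost (run A \<sigma>) \<and>
        real (card Q) / 2 * real (OPT k \<sigma>) \<le> real (card Q) * real k / 2 + real n"
      using \<sigma>(3) by (intro bexI[of _ \<sigma>]) simp_all
  qed
  then show "ereal (real (card Q) / 2) \<le> x"
    by (simp add: x)
qed

section \<open>Critical hypergraphs\<close>

text \<open>A 2-colouring is represented by one of its colour classes.\<close>

definition monochromatic :: "'a set \<Rightarrow> 'a set \<Rightarrow> bool" where
  "monochromatic X S \<longleftrightarrow> S \<subseteq> X \<or> S \<inter> X = {}"

definition two_colourable :: "'a set set \<Rightarrow> bool" where
  "two_colourable Z \<longleftrightarrow> (\<exists>X. \<forall>S\<in>Z. \<not> monochromatic X S)"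

definition critical :: "'a set set \<Rightarrow> bool" where
  "critical Z \<longleftrightarrow> \<not> two_colourable Z \<and> (\<forall>S\<in>Z. two_colourable (Z - {S}))"

lemma monochromatic_Compl [simp]: "monochromatic (- X) S \<longleftrightarrow> monochromatic X S"
  by (auto simp: monochromatic_def)

lemma monochromatic_image: "monochromatic X (h ` S) \<longleftrightarrow> monochromatic (h -` X) S"
  by (auto simp: monochromatic_def)

lemma monochromatic_member:
  assumes "\<not> two_colourable Z"
  obtains S where "S \<in> Z" "monochromatic X S"
  using assms by (auto simp: two_colourable_def)

lemma critical_not_two_colourable: "critical Z \<Longrightarrow> \<not> two_colourable Z"
  by (simp add: critical_def)

lemma criticalI:
  assumes "\<not> two_colourable Z"
    and "\<And>S. S \<in> Z \<Longrightarrow> \<exists>X. \<forall>T\<in>Z. monochromatic X T \<longrightarrow> T = S"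
  shows "critical Z"
proof -
  have "two_colourable (Z - {S})" if "S \<in> Z" for S
    using assms(2)[OF that] by (auto simp: two_colourable_def)
  then show ?thesis
    using assms(1) by (simp add: critical_def)
qed

lemma critical_colouring:
  assumes "critical Z" "S \<in> Z"
  obtains X where "S \<subseteq> X" "\<And>T. T \<in> Z \<Longrightarrow> monochromatic X T \<Longrightarrow> T = S"
proof -
  have "two_colourable (Z - {S})"
    using assms by (simp add: critical_def)
  then obtain X where "\<forall>T\<in>Z - {S}. \<not> monochromatic X T"
    unfolding two_colourable_def by blast
  then have X: "T = S" if "T \<in> Z" "monochromatic X T" for T
    using that by blast
  have "monochromatic X S"
    using monochromatic_member[OF critical_not_two_colourable[OF assms(1)]] X by metis
  then consider "S \<subseteq> X" | "S \<subseteq> - X"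
    by (auto simp: monochromatic_def)
  then show thesis
    using that[of X] that[of "- X"] X by cases simp_all
qed

lemma critical_image:
  assumes "critical Z" "inj_on h (\<Union>Z)"
  shows "critical ((`) h ` Z)"
proof (rule criticalI)
  show "\<not> two_colourable ((`) h ` Z)"
    using critical_not_two_colourable[OF assms(1)]
    by (auto simp: two_colourable_def monochromatic_image)
next
  fix S assume "S \<in> (`) h ` Z"
  then obtain S' where S': "S' \<in> Z" "S = h ` S'"
    by blast
  obtain X where X: "\<And>T. T \<in> Z \<Longrightarrow> monochromatic X T \<Longrightarrow> T = S'"
    using critical_colouring[OF assms(1) S'(1)] by metis
  have "monochromatic X T" if "monochromatic (h ` (X \<inter> \<Union>Z)) (h ` T)" "T \<in> Z" for T
    using that assms(2) unfolding monochromatic_def inj_on_def by blast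
  then show "\<exists>X. \<forall>T\<in>(`) h ` Z. monochromatic X T \<longrightarrow> T = S"
    using X S'(2) by (intro exI[of _ "h ` (X \<inter> \<Union>Z)"]) blast
qed

subsection \<open>The \<open>n\<close>-subsets of \<open>2 n - 1\<close> points\<close>

lemma not_two_colourable_majority_subsets:
  assumes "finite I" "2 * n - 1 \<le> card I"
  shows "\<not> two_colourable {S. S \<subseteq> I \<and> card S = n}"
proof -
  have "\<exists>S\<in>{S. S \<subseteq> I \<and> card S = n}. monochromatic X S" for X
  proof -
    have "2 * n - 1 \<le> card (I \<inter> X) + card (I - X)"
      using card_Int_Diff[OF assms(1)] assms(2) by metis
    then consider "n \<le> card (I \<inter> X)" | "n \<le> card (I - X)"
      by linarith
    then obtain S where "card S = n" "S \<subseteq> I \<inter> X \<or> S \<subseteq> I - X"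
      by cases (metis obtain_subset_with_card_n)+
    then show ?thesis
      by (intro bexI[of _ S]) (auto simp: monochromatic_def)
  qed
  then show ?thesis
    unfolding two_colourable_def by metis
qed

lemma Int_nonempty_of_card_less:
  assumes "finite I" "S \<subseteq> I" "T \<subseteq> I" "card I < card S + card T"
  shows "S \<inter> T \<noteq> {}"
proof
  assume "S \<inter> T = {}"
  then have "card S + card T = card (S \<union> T)"
    using assms finite_subset by (metis card_Un_disjoint)
  also have "\<dots> \<le> card I"
    using assms by (intro card_mono) auto
  finally show False
    using assms(4) by simp
qed

lemma critical_majority_subsets:
  assumes "card I = 2 * n - 1" "1 \<le> n"
  shows "critical {S. S \<subseteq> I \<and> card S = n}"
proof (rule criticalI)
  have fin: "finite I"
    using assms by (intro card_ge_0_finite) simp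
  then show "\<not> two_colourable {S. S \<subseteq> I \<and> card S = n}"
    using assms(1) by (intro not_two_colourable_majority_subsets) simp_all
  fix S assume S: "S \<in> {S. S \<subseteq> I \<and> card S = n}"
  have "T = S" if T: "T \<subseteq> I" "card T = n" and "monochromatic S T" for T
  proof -
    have "T \<inter> S \<noteq> {}"
      using S T assms by (intro Int_nonempty_of_card_less[OF fin]) auto
    then have "T \<subseteq> S"
      using that(3) by (simp add: monochromatic_def)
    then show ?thesis
      using S T(2) finite_subset[OF _ fin] by (intro card_subset_eq) auto
  qed
  then show "\<exists>X. \<forall>T\<in>{S. S \<subseteq> I \<and> card S = n}. monochromatic X T \<longrightarrow> T = S"
    by blast
qed

subsection \<open>Odd cycles\<close>

definition cycle_edge :: "nat \<Rightarrow> nat \<Rightarrow> nat set" where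
  "cycle_edge j i = {i, Suc i mod j}"

lemma not_two_colourable_odd_cycle:
  assumes "odd j"
  shows "\<not> two_colourable (cycle_edge j ` {..<j})"
proof
  assume "two_colourable (cycle_edge j ` {..<j})"
  then obtain X where "\<not> monochromatic X (cycle_edge j i)" if "i < j" for i
    by (auto simp: two_colourable_def)
  then have alternating: "Suc i mod j \<in> X \<longleftrightarrow> i \<notin> X" if "i < j" for i
    using that by (fastforce simp: monochromatic_def cycle_edge_def)
  have "i \<in> X \<longleftrightarrow> (0 \<in> X \<longleftrightarrow> even i)" if "i < j" for i
    using that
  proof (induction i)
    case (Suc i)
    then show ?case
      using alternating[of i] by auto
  qed simp
  from this[of "j - 1"] alternating[of "j - 1"] assms show False
    by (cases j) auto
qed

text \<open>Colours alternate along the path from the successor of \<open>e\<close> around the cycle to \<open>e\<close>, which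
  has an even number of edges.\<close>

definition alternating_colouring :: "nat \<Rightarrow> nat set" where
  "alternating_colouring e = {i. even (i + e) \<longleftrightarrow> i \<le> e}"

lemma monochromatic_alternating_colouring:
  assumes "odd j" "e < j" "i < j"
  shows "monochromatic (alternating_colouring e) (cycle_edge j i) \<longleftrightarrow> i = e"
proof -
  have "(i \<in> alternating_colouring e \<longleftrightarrow> Suc i mod j \<in> alternating_colouring e) \<longleftrightarrow> i = e"
  proof (cases "Suc i = j")
    case True
    then show ?thesis
      using assms by (auto simp: alternating_colouring_def)
  next
    case False
    then have "Suc i mod j = Suc i"
      using assms by simp
    then show ?thesis
      by (auto simp: alternating_colouring_def le_less Suc_le_eq)
  qed
  then show ?thesis
    by (auto simp: monochromatic_def cycle_edge_def)
qed

lemma inj_on_cycle_edge: "odd j \<Longrightarrow> inj_on (cycle_edge j) {..<j}"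
  by (rule inj_onI) (metis lessThan_iff monochromatic_alternating_colouring)

lemma critical_odd_cycle:
  assumes "odd j"
  shows "critical (cycle_edge j ` {..<j})"
proof (rule criticalI[OF not_two_colourable_odd_cycle[OF assms]])
  fix S assume "S \<in> cycle_edge j ` {..<j}"
  then obtain e where "e < j" "S = cycle_edge j e"
    by auto
  then show "\<exists>X. \<forall>T\<in>cycle_edge j ` {..<j}. monochromatic X T \<longrightarrow> T = S"
    using monochromatic_alternating_colouring[OF assms]
    by (intro exI[of _ "alternating_colouring e"]) auto
qed

lemma card_cycle_edge:
  assumes "1 < j" "i < j"
  shows "card (cycle_edge j i) = 2"
  using assms by (simp add: cycle_edge_def mod_Suc)

subsection \<open>Blow-ups\<close>

definition blow_up :: "'i set set \<Rightarrow> ('i \<Rightarrow> 'a set set) \<Rightarrow> ('i \<times> 'a) set set" where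
  "blow_up H E = (\<Union>G\<in>H. Sigma G ` Pi\<^sub>E G E)"

lemma blow_upI: "G \<in> H \<Longrightarrow> e \<in> Pi G E \<Longrightarrow> Sigma G e \<in> blow_up H E"
  unfolding blow_up_def
  by (rule UN_I, assumption, rule image_eqI[of _ _ "restrict e G"]) auto

lemma blow_upE:
  assumes "S \<in> blow_up H E"
  obtains G e where "G \<in> H" "e \<in> Pi\<^sub>E G E" "S = Sigma G e"
  using assms by (auto simp: blow_up_def)

lemma not_two_colourable_blow_up:
  assumes "\<not> two_colourable H" "\<And>g. g \<in> \<Union>H \<Longrightarrow> \<not> two_colourable (E g)"
  shows "\<not> two_colourable (blow_up H E)"
proof -
  have "\<exists>S\<in>blow_up H E. monochromatic X S" for X
  proof -
    have "\<exists>T\<in>E g. monochromatic (Pair g -` X) T" if "g \<in> \<Union>H" for g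
      using monochromatic_member[OF assms(2)[OF that]] by metis
    then obtain e where e: "\<And>g. g \<in> \<Union>H \<Longrightarrow> e g \<in> E g \<and> monochromatic (Pair g -` X) (e g)"
      by metis
    obtain G where G: "G \<in> H" "monochromatic {g. e g \<subseteq> Pair g -` X} G"
      using monochromatic_member[OF assms(1)] .
    have "monochromatic X (Sigma G e)"
      using G e unfolding monochromatic_def by fast
    then show ?thesis
      using e G(1) by (intro bexI[of _ "Sigma G e"] blow_upI) auto
  qed
  then show ?thesis
    unfolding two_colourable_def by metis
qed

definition product_colouring :: "'i set \<Rightarrow> ('i \<Rightarrow> 'a set) \<Rightarrow> ('i \<times> 'a) set" where
  "product_colouring Y c = {(g, v). v \<in> c g \<longleftrightarrow> g \<in> Y}"

lemma monochromatic_product_colouringD: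
  assumes "monochromatic (product_colouring Y c) (Sigma G e)"
  shows "g \<in> G \<Longrightarrow> monochromatic (c g) (e g)"
    and "(\<And>g. g \<in> G \<Longrightarrow> e g \<noteq> {} \<and> e g \<subseteq> c g) \<Longrightarrow> monochromatic Y G"
proof -
  show "monochromatic (c g) (e g)" if "g \<in> G"
    using assms that by (auto simp: monochromatic_def product_colouring_def)
  assume "\<And>g. g \<in> G \<Longrightarrow> e g \<noteq> {} \<and> e g \<subseteq> c g"
  then have "\<exists>v\<in>e g. (g, v) \<in> product_colouring Y c \<longleftrightarrow> g \<in> Y" if "g \<in> G" for g
    using that by (fastforce simp: product_colouring_def)
  then show "monochromatic Y G"
    using assms unfolding monochromatic_def by blast
qed

lemma critical_blow_up:
  assumes H: "critical H" and E: "\<And>g. g \<in> \<Union>H \<Longrightarrow> critical (E g)" "\<And>g. g \<in> \<Union>H \<Longrightarrow> {} \<notin> E g"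
  shows "critical (blow_up H E)"
proof (rule criticalI)
  show "\<not> two_colourable (blow_up H E)"
    using H E(1) by (intro not_two_colourable_blow_up critical_not_two_colourable)
next
  fix S assume "S \<in> blow_up H E"
  then obtain G e where G: "G \<in> H" "e \<in> Pi\<^sub>E G E" "S = Sigma G e"
    by (rule blow_upE)
  obtain Y where Y: "\<And>G'. G' \<in> H \<Longrightarrow> monochromatic Y G' \<Longrightarrow> G' = G"
    using critical_colouring[OF H G(1)] by metis
  have "\<exists>d. d \<in> E g \<and> (g \<in> G \<longrightarrow> d = e g)" if "g \<in> \<Union>H" for g
    using monochromatic_member[OF critical_not_two_colourable[OF E(1)[OF that]]] G(2)
    by (metis PiE_mem)
  then obtain d where d: "\<And>g. g \<in> \<Union>H \<Longrightarrow> d g \<in> E g" "\<And>g. g \<in> G \<Longrightarrow> d g = e g"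
    using G(1) by (metis UnionI)
  have "\<exists>c. d g \<subseteq> c \<and> (\<forall>T\<in>E g. monochromatic c T \<longrightarrow> T = d g)" if "g \<in> \<Union>H" for g
    using critical_colouring[OF E(1)[OF that] d(1)[OF that]] by metis
  then obtain c where c: "\<And>g. g \<in> \<Union>H \<Longrightarrow> d g \<subseteq> c g"
    "\<And>g T. g \<in> \<Union>H \<Longrightarrow> T \<in> E g \<Longrightarrow> monochromatic (c g) T \<Longrightarrow> T = d g"
    by metis
  have "Sigma G' e' = S"
    if G': "G' \<in> H" "e' \<in> Pi\<^sub>E G' E" and mono: "monochromatic (product_colouring Y c) (Sigma G' e')"
    for G' e'
  proof -
    have e': "e' g = d g" if "g \<in> G'" for g
      using c(2) monochromatic_product_colouringD(1)[OF mono that] G' that by blast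
    have "e' g \<noteq> {} \<and> e' g \<subseteq> c g" if "g \<in> G'" for g
      using E(2)[of g] c(1)[of g] d(1)[of g] e'[OF that] G'(1) that by (metis UnionI)
    then have "G' = G"
      using Y[OF G'(1)] monochromatic_product_colouringD(2)[OF mono] by simp
    then show ?thesis
      using e' d(2) G(3) by auto
  qed
  then show "\<exists>X. \<forall>T\<in>blow_up H E. monochromatic X T \<longrightarrow> T = S"
    by (intro exI[of _ "product_colouring Y c"]) (auto elim: blow_upE)
qed

lemma blow_up_subset_Pow:
  assumes "H \<subseteq> Pow I" "\<And>g. g \<in> I \<Longrightarrow> E g \<subseteq> Pow V"
  shows "blow_up H E \<subseteq> Pow (I \<times> V)"
proof
  fix S assume "S \<in> blow_up H E"
  then obtain G e where G: "G \<in> H" "e \<in> Pi\<^sub>E G E" "S = Sigma G e"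
    by (rule blow_upE)
  then have "G \<subseteq> I"
    using assms(1) by blast
  moreover from this have "e g \<subseteq> V" if "g \<in> G" for g
    using assms(2)[of g] PiE_mem[OF G(2) that] that by blast
  ultimately show "S \<in> Pow (I \<times> V)"
    using G(3) by blast
qed

lemma card_edge_blow_up:
  assumes "S \<in> blow_up H E"
    and "\<And>G. G \<in> H \<Longrightarrow> finite G \<and> card G = n"
    and "\<And>g T. g \<in> \<Union>H \<Longrightarrow> T \<in> E g \<Longrightarrow> finite T \<and> card T = r"
  shows "card S = n * r"
proof -
  obtain G e where G: "G \<in> H" "e \<in> Pi\<^sub>E G E" "S = Sigma G e"
    using assms(1) by (rule blow_upE)
  have "finite (e g) \<and> card (e g) = r" if "g \<in> G" for g
    using assms(3)[of g "e g"] PiE_mem[OF G(2) that] G(1) that by blast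
  then show ?thesis
    using G(1,3) assms(2) by simp
qed

lemma card_blow_up:
  assumes fin: "finite H" "\<And>G. G \<in> H \<Longrightarrow> finite G" "\<And>g. g \<in> \<Union>H \<Longrightarrow> finite (E g)"
    and nonempty: "\<And>g. g \<in> \<Union>H \<Longrightarrow> {} \<notin> E g"
  shows "card (blow_up H E) = (\<Sum>G\<in>H. \<Prod>g\<in>G. card (E g))"
proof -
  have "e g \<noteq> {}" if "G \<in> H" "e \<in> Pi\<^sub>E G E" "g \<in> G" for G e g
    using nonempty[of g] that by (metis PiE_mem UnionI)
  then have fst_Sigma: "fst ` Sigma G e = G" if "G \<in> H" "e \<in> Pi\<^sub>E G E" for G e
    using that by (auto simp: fst_image_Sigma)
  have disjoint: "Sigma G ` Pi\<^sub>E G E \<inter> Sigma G' ` Pi\<^sub>E G' E = {}"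
    if "G \<in> H" "G' \<in> H" "G \<noteq> G'" for G G'
  proof (rule equals0I)
    fix S assume "S \<in> Sigma G ` Pi\<^sub>E G E \<inter> Sigma G' ` Pi\<^sub>E G' E"
    then have "fst ` S = G" "fst ` S = G'"
      using fst_Sigma that(1,2) by (metis IntD1 imageE, metis IntD2 imageE)
    then show False
      using that(3) by simp
  qed
  have finite: "finite (Pi\<^sub>E G E)" if "G \<in> H" for G
    using fin that by (intro finite_PiE) auto
  have "inj_on (Sigma G) (Pi\<^sub>E G E)" for G
    by (intro inj_onI PiE_ext) (assumption+, blast)
  then have "card (Sigma G ` Pi\<^sub>E G E) = (\<Prod>g\<in>G. card (E g))" if "G \<in> H" for G
    using that fin(2) by (simp add: card_image card_PiE)
  moreover have "card (blow_up H E) = (\<Sum>G\<in>H. card (Sigma G ` Pi\<^sub>E G E))"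
    unfolding blow_up_def using fin(1) finite disjoint by (intro card_UN_disjoint) auto
  ultimately show ?thesis
    by simp
qed

section \<open>Lower bounds from critical hypergraphs\<close>

definition two_page_config :: "nat \<Rightarrow> slot set \<Rightarrow> page \<Rightarrow> page \<Rightarrow> config" where
  "two_page_config k X p q = (\<lambda>s. Some (if s \<in> X then p else q)) |` {1..k}"

lemma is_config_two_page_config: "is_config k (two_page_config k X p q)"
  by (auto simp: is_config_def two_page_config_def)

lemma satisfies_two_page_config:
  assumes "S \<subseteq> {1..k}" "p \<noteq> q"
  shows "satisfies (two_page_config k X p q) (p, S) \<longleftrightarrow> S \<inter> X \<noteq> {}"
    and "satisfies (two_page_config k X p q) (q, S) \<longleftrightarrow> \<not> S \<subseteq> X"
proof -
  have "two_page_config k X p q s = Some (if s \<in> X then p else q)" if "s \<in> S" for s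
    using assms(1) that by (auto simp: two_page_config_def)
  then show "satisfies (two_page_config k X p q) (p, S) \<longleftrightarrow> S \<inter> X \<noteq> {}"
    and "satisfies (two_page_config k X p q) (q, S) \<longleftrightarrow> \<not> S \<subseteq> X"
    using assms(2) by (auto simp: satisfies_def)
qed

lemma unsatisfiable_two_pages:
  assumes "\<not> two_colourable Z" "p \<noteq> q"
  shows "\<not> satisfiable k ({p, q} \<times> Z)"
proof -
  have "\<exists>r\<in>{p, q} \<times> Z. \<not> satisfies C r" for C
  proof -
    obtain S where "S \<in> Z" "monochromatic {s. C s = Some p} S"
      using monochromatic_member[OF assms(1)] .
    moreover from this have "\<not> satisfies C (p, S) \<or> \<not> satisfies C (q, S)"
      using assms(2) by (auto simp: monochromatic_def satisfies_def)
    ultimately show ?thesis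
      by blast
  qed
  then show ?thesis
    unfolding satisfiable_def by metis
qed

lemma minimal_unsatisfiable_two_pages:
  assumes Z: "critical Z" "Z \<subseteq> Pow {1..k}" "{} \<notin> Z" and "p \<noteq> q"
  shows "minimal_unsatisfiable k ({p, q} \<times> Z)"
  unfolding minimal_unsatisfiable_def
proof
  show "\<not> satisfiable k ({p, q} \<times> Z)"
    using Z(1) \<open>p \<noteq> q\<close> by (intro unsatisfiable_two_pages critical_not_two_colourable)
next
  show "\<forall>r\<in>{p, q} \<times> Z. satisfiable k ({p, q} \<times> Z - {r})"
  proof clarify
    fix a S assume a: "a \<in> {p, q}" and S: "S \<in> Z"
    obtain a' where a': "{p, q} = {a, a'}" "a' \<noteq> a"
      using a \<open>p \<noteq> q\<close> by blast
    obtain X where X: "S \<subseteq> X" "\<And>T. T \<in> Z \<Longrightarrow> monochromatic X T \<Longrightarrow> T = S"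
      using critical_colouring[OF Z(1) S] by metis
    have "satisfies (two_page_config k X a' a) r" if r: "r \<in> {p, q} \<times> Z - {(a, S)}" for r
    proof -
      obtain b T where T: "r = (b, T)" "b = a' \<or> b = a \<and> T \<noteq> S" "T \<in> Z"
        using r a'(1) by (cases r) auto
      have "T \<noteq> {}" "T \<subseteq> {1..k}"
        using Z(2,3) T(3) by blast+
      moreover have "T \<inter> X \<noteq> {}"
        using X T(3) \<open>T \<noteq> {}\<close> unfolding monochromatic_def by blast
      moreover have "\<not> T \<subseteq> X" if "T \<noteq> S"
        using X(2)[OF T(3)] that by (auto simp: monochromatic_def)
      ultimately show ?thesis
        using T(1,2) satisfies_two_page_config[OF _ a'(2)] by metis
    qed
    then show "satisfiable k ({p, q} \<times> Z - {(a, S)})"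
      unfolding satisfiable_def using is_config_two_page_config by blast
  qed
qed

theorem card_critical_le_det_ratio:
  assumes "critical Z" "Z \<subseteq> Pow {1..k}" "{} \<notin> Z" "Z \<subseteq> F"
  shows "ereal (real (card Z)) \<le> det_ratio k F"
proof -
  have "finite Z"
    using assms(2) finite_subset by blast
  have "minimal_unsatisfiable k ({0, 1} \<times> Z)"
    using assms by (intro minimal_unsatisfiable_two_pages) auto
  then have "ereal (real (card ({0::page, 1} \<times> Z)) / 2) \<le> det_ratio k F"
    using \<open>finite Z\<close> assms(4) by (intro card_minimal_unsatisfiable_le_det_ratio) auto
  then show ?thesis
    by (simp add: card_cartesian_product)
qed

lemma card_critical_uniform_le_det_ratio:
  assumes "critical Z" "Z \<subseteq> Pow V" "finite V" "card V \<le> k"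
    and uniform: "\<And>S. S \<in> Z \<Longrightarrow> card S = m" and "0 < m"
  shows "ereal (real (card Z)) \<le> det_ratio k (one_out_of m k)"
proof -
  obtain h where h: "h ` V \<subseteq> {1..k}" "inj_on h V"
    using card_le_inj[of V "{1..k}"] assms(3,4) by auto
  have "inj_on ((`) h) Z"
    using inj_on_subset[OF inj_on_image_Pow[OF h(2)] assms(2)] .
  then have "card ((`) h ` Z) = card Z"
    by (rule card_image)
  moreover have "ereal (real (card ((`) h ` Z))) \<le> det_ratio k (one_out_of m k)"
  proof (rule card_critical_le_det_ratio)
    show "critical ((`) h ` Z)"
      by (rule critical_image[OF assms(1) inj_on_subset[OF h(2)]]) (use assms(2) in blast)
    show slots: "(`) h ` Z \<subseteq> Pow {1..k}"
      using h(1) assms(2) by blast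
    have "card (h ` S) = m" if "S \<in> Z" for S
      using card_image[OF inj_on_subset[OF h(2)]] uniform[OF that] that assms(2) by blast
    then show "{} \<notin> (`) h ` Z" "(`) h ` Z \<subseteq> one_out_of m k"
      using slots \<open>0 < m\<close> by (force, auto simp: one_out_of_def)
  qed
  ultimately show ?thesis
    by simp
qed

lemma binomial_le_det_ratio:
  assumes "1 \<le> m" "2 * m - 1 \<le> k"
  shows "ereal (real ((2 * m - 1) choose m)) \<le> det_ratio k (one_out_of m k)"
proof -
  let ?Z = "{S. S \<subseteq> {..<2 * m - 1} \<and> card S = m}"
  have "ereal (real (card ?Z)) \<le> det_ratio k (one_out_of m k)"
    using assms
    by (intro card_critical_uniform_le_det_ratio[where V = "{..<2 * m - 1}"]
        critical_majority_subsets) auto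
  then show ?thesis
    by (simp add: n_subsets)
qed

lemma binomial_mult_power_le_det_ratio:
  assumes "odd j" "1 < j" "1 \<le> n" "j * (2 * n - 1) \<le> k"
  shows "ereal (real (((2 * n - 1) choose n) * j ^ n)) \<le> det_ratio k (one_out_of (2 * n) k)"
proof -
  define H where "H = {G. G \<subseteq> {..<2 * n - 1} \<and> card G = n}"
  define E where "E = cycle_edge j ` {..<j}"
  let ?Z = "blow_up H (\<lambda>_. E)"
  have H: "finite G \<and> card G = n" if "G \<in> H" for G
    using that finite_subset by (auto simp: H_def)
  have E: "finite T \<and> card T = 2" "T \<subseteq> {..<j}" if "T \<in> E" for T
    using that card_cycle_edge[OF assms(2)] assms(2) by (auto simp: E_def cycle_edge_def)
  then have nonempty: "{} \<notin> E"
    by fastforce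
  have "ereal (real (card ?Z)) \<le> det_ratio k (one_out_of (2 * n) k)"
  proof (rule card_critical_uniform_le_det_ratio)
    have "critical H" "critical E"
      using assms(1,3) by (simp_all add: H_def E_def critical_majority_subsets critical_odd_cycle)
    then show "critical ?Z"
      using nonempty by (rule critical_blow_up)
    show "?Z \<subseteq> Pow ({..<2 * n - 1} \<times> {..<j})"
      by (rule blow_up_subset_Pow) (use E(2) in \<open>auto simp: H_def\<close>)
    have "card S = n * 2" if "S \<in> ?Z" for S
      using that H E(1) by (rule card_edge_blow_up)
    then show "card S = 2 * n" if "S \<in> ?Z" for S
      using that by simp
  qed (use assms(3,4) in \<open>simp_all add: mult.commute\<close>)
  also have "card ?Z = (\<Sum>G\<in>H. \<Prod>g\<in>G. card E)"
    using H nonempty by (intro card_blow_up) (simp_all add: H_def E_def)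
  also have "\<dots> = ((2 * n - 1) choose n) * j ^ n"
    using H card_image[OF inj_on_cycle_edge[OF assms(1)]] by (simp add: H_def E_def n_subsets)
  finally show ?thesis .
qed

section \<open>Asymptotics\<close>

lemma central_binomial_Suc:
  "Suc n * ((2 * Suc n) choose Suc n) = 2 * (2 * n + 1) * ((2 * n) choose n)"
proof -
  have "Suc n * ((2 * Suc n) choose Suc n) = 2 * (Suc n * ((2 * n + 1) choose n))"
    using Suc_times_binomial[of n "2 * n + 1"] by simp
  also have "(2 * n + 1) choose n = (2 * n + 1) choose Suc n"
    by (subst binomial_symmetric) auto
  also have "Suc n * \<dots> = (2 * n + 1) * ((2 * n) choose n)"
    using Suc_times_binomial[of n "2 * n"] by simp
  finally show ?thesis
    by simp
qed

lemma central_binomial_square_Suc: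
  "(Suc n)\<^sup>2 * ((2 * Suc n) choose Suc n)\<^sup>2 = 4 * (2 * n + 1)\<^sup>2 * ((2 * n) choose n)\<^sup>2"
proof -
  have "(Suc n)\<^sup>2 * ((2 * Suc n) choose Suc n)\<^sup>2 = (2 * (2 * n + 1) * ((2 * n) choose n))\<^sup>2"
    by (simp only: central_binomial_Suc flip: power_mult_distrib)
  also have "\<dots> = 4 * (2 * n + 1)\<^sup>2 * ((2 * n) choose n)\<^sup>2"
    by (simp only: power_mult_distrib) simp
  finally show ?thesis .
qed

lemma central_binomial_square_le: "(2 * n + 1) * ((2 * n) choose n)\<^sup>2 \<le> 16 ^ n"
proof (induction n)
  case (Suc n)
  define a where "a n = ((2 * n) choose n)\<^sup>2" for n :: nat
  have rec: "(Suc n)\<^sup>2 * a (Suc n) = 4 * (2 * n + 1)\<^sup>2 * a n"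
    by (simp only: a_def central_binomial_square_Suc)
  have "(Suc n)\<^sup>2 * ((2 * Suc n + 1) * a (Suc n)) = (2 * n + 3) * ((Suc n)\<^sup>2 * a (Suc n))"
    by (simp add: algebra_simps)
  also have "\<dots> = 4 * (2 * n + 3) * (2 * n + 1) * ((2 * n + 1) * a n)"
    by (simp only: rec) (simp add: power2_eq_square algebra_simps)
  also have "\<dots> \<le> 16 * (Suc n)\<^sup>2 * 16 ^ n"
    by (rule mult_mono[OF _ Suc.IH[folded a_def]]) (simp_all add: power2_eq_square algebra_simps)
  finally have "(2 * Suc n + 1) * a (Suc n) \<le> 16 ^ Suc n"
    by simp
  then show ?case
    by (simp only: a_def)
qed simp

lemma central_binomial_square_ge:
  assumes "1 \<le> n"
  shows "16 ^ n \<le> 4 * n * ((2 * n) choose n)\<^sup>2"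
  using assms
proof (induction n rule: dec_induct)
  case (step n)
  define a where "a n = ((2 * n) choose n)\<^sup>2" for n :: nat
  have rec: "(Suc n)\<^sup>2 * a (Suc n) = 4 * (2 * n + 1)\<^sup>2 * a n"
    by (simp only: a_def central_binomial_square_Suc)
  have "Suc n * 16 ^ Suc n = 16 * Suc n * 16 ^ n"
    by (simp add: algebra_simps)
  also have "\<dots> \<le> 16 * Suc n * (4 * n * a n)"
    by (rule mult_left_mono[OF step.IH[folded a_def]]) simp
  also have "\<dots> \<le> 4 * (4 * (2 * n + 1)\<^sup>2 * a n)"
    by (simp add: power2_eq_square algebra_simps)
  also have "\<dots> = 4 * ((Suc n)\<^sup>2 * a (Suc n))"
    by (simp only: rec)
  also have "\<dots> = Suc n * (4 * Suc n * a (Suc n))"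
    by (simp add: power2_eq_square algebra_simps)
  finally have "16 ^ Suc n \<le> 4 * Suc n * a (Suc n)"
    by (simp only: Suc_mult_le_cancel1)
  then show ?case
    by (simp only: a_def)
qed simp

lemma
  assumes "1 \<le> n"
  shows odd_central_binomial_le: "real ((2 * n - 1) choose n) \<le> 4 ^ n / (2 * sqrt (2 * real n))"
    and odd_central_binomial_ge: "4 ^ n / (4 * sqrt (real n)) \<le> real ((2 * n - 1) choose n)"
proof -
  let ?c = "real ((2 * n) choose n)"
  have "(2 * n) choose n = 2 * ((2 * n - 1) choose n)"
    using assms binomial_symmetric[of "n - 1" "2 * n - 1"] by (simp add: choose_reduce_nat)
  then have half: "?c = 2 * real ((2 * n - 1) choose n)"
    by simp
  have square: "(16 :: real) ^ n = (4 ^ n)\<^sup>2"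
    by (simp add: power2_eq_square flip: power_mult_distrib)
  have "real (2 * n) * ?c\<^sup>2 \<le> real (2 * n + 1) * ?c\<^sup>2"
    by (intro mult_right_mono) auto
  also have "\<dots> \<le> 16 ^ n"
    using of_nat_mono[OF central_binomial_square_le[of n], where 'a = real]
    by (simp only: of_nat_mult of_nat_power of_nat_numeral)
  finally have "(sqrt (2 * real n) * ?c)\<^sup>2 \<le> (4 ^ n)\<^sup>2"
    by (simp add: power_mult_distrib flip: square)
  then have "sqrt (2 * real n) * ?c \<le> 4 ^ n"
    by (rule power2_le_imp_le) simp
  then show "real ((2 * n - 1) choose n) \<le> 4 ^ n / (2 * sqrt (2 * real n))"
    using assms unfolding half by (simp add: field_simps)
  have "16 ^ n \<le> 4 * real n * ?c\<^sup>2"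
    using of_nat_mono[OF central_binomial_square_ge[OF assms], where 'a = real] by simp
  then have "(4 ^ n)\<^sup>2 \<le> (2 * sqrt (real n) * ?c)\<^sup>2"
    by (simp add: power_mult_distrib flip: square)
  then have "4 ^ n \<le> 2 * sqrt (real n) * ?c"
    by (rule power2_le_imp_le) simp
  then show "4 ^ n / (4 * sqrt (real n)) \<le> real ((2 * n - 1) choose n)"
    using assms unfolding half by (simp add: field_simps)
qed

lemma two_power_le_odd_central_binomial:
  fixes k :: nat
  defines "n \<equiv> (k + 1) div 2"
  shows "1 / 4 * (2 ^ k / sqrt (real k)) \<le> real ((2 * n - 1) choose n)"
proof (cases "k = 0")
  case False
  then have n: "1 \<le> n" "n \<le> k" "k \<le> 2 * n"
    by (auto simp: n_def)
  have "(2::real) ^ k \<le> 2 ^ (2 * n)"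
    using n by (intro power_increasing) auto
  then have "2 ^ k / sqrt (real k) \<le> 4 ^ n / sqrt (real n)"
    using n by (intro frac_le) (auto simp: power_mult)
  then show ?thesis
    using odd_central_binomial_ge[OF n(1)] by simp
qed simp

lemma half_binomial_bigomega:
  "(\<lambda>k. real (k choose ((k + 1) div 2))) \<in> \<Omega>[F](\<lambda>k. 2 ^ k / sqrt (real k))"
proof (rule landau_omega.bigI[of "1 / 4"])
  have "1 / 4 * (2 ^ k / sqrt (real k)) \<le> real (k choose ((k + 1) div 2))" for k
    by (rule order_trans[OF two_power_le_odd_central_binomial of_nat_mono[OF binomial_right_mono]])
      linarith
  then show "\<forall>\<^sub>F k in F.
      1 / 4 * norm (2 ^ k / sqrt (real k) :: real) \<le> norm (real (k choose ((k + 1) div 2)))"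
    by (intro always_eventually) simp
qed simp

lemma power_le_fact_mult_exp:
  fixes x :: real
  assumes "0 \<le> x"
  shows "x ^ n \<le> fact n * exp x"
proof -
  have "(\<Sum>i\<in>{n}. x ^ i /\<^sub>R fact i) \<le> exp x"
    unfolding exp_def using assms by (intro sum_le_suminf summable_exp_generic) auto
  then show ?thesis
    by (simp add: field_simps)
qed

lemma binomial_le_exp_power: "real (k choose m) \<le> (exp 1 * real k / real m) ^ m"
proof (cases "m = 0")
  case False
  have "real (k choose m) * real m ^ m \<le> real (k choose m) * (fact m * exp (real m))"
    by (intro mult_left_mono power_le_fact_mult_exp) auto
  also have "\<dots> = real ((k choose m) * fact m) * exp 1 ^ m"
    by (simp flip: exp_of_nat_mult)
  also have "\<dots> \<le> real (k ^ m) * exp 1 ^ m"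
    by (intro mult_right_mono of_nat_mono binomial_fact_pow) auto
  finally show ?thesis
    using False by (simp add: field_simps)
qed simp

text \<open>The number of edges of the blow-up of the \<open>m / 2\<close>-subsets of \<open>m - 1\<close> points to odd cycles of
  length \<open>k / (m - 1)\<close>.\<close>

definition blow_up_size :: "nat \<Rightarrow> nat \<Rightarrow> real" where
  "blow_up_size m k = real ((m - 1) choose (m div 2)) * (real k / real (m - 1)) ^ (m div 2)"

definition blow_up_rate :: "nat \<Rightarrow> nat \<Rightarrow> real" where
  "blow_up_rate m k = (4 * real k / real m) ^ (m div 2) / sqrt (real m)"

lemma blow_up_rate_nonneg: "0 \<le> blow_up_rate m k"
  by (simp add: blow_up_rate_def)

lemma blow_up_rate_double:
  "blow_up_rate (2 * n) k = 4 ^ n * (real k / real (2 * n)) ^ n / sqrt (2 * real n)"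
proof -
  have "4 * real k / real (2 * n) = 4 * (real k / real (2 * n))"
    by simp
  then show ?thesis
    unfolding blow_up_rate_def by (simp only: power_mult_distrib) simp
qed

lemma blow_up_size_ge:
  assumes "even m" "0 < m"
  shows "sqrt 2 / 4 * blow_up_rate m k \<le> blow_up_size m k"
proof -
  obtain n where n: "m = 2 * n" "1 \<le> n"
    using assms by (auto elim!: evenE)
  have "sqrt 2 / 4 * blow_up_rate m k = 4 ^ n / (4 * sqrt (real n)) * (real k / real (2 * n)) ^ n"
    using n by (simp add: blow_up_rate_double real_sqrt_mult)
  also have "\<dots> \<le> real ((2 * n - 1) choose n) * (real k / real (2 * n - 1)) ^ n"
    using n(2) odd_central_binomial_ge[OF n(2)] by (intro mult_mono power_mono frac_le) auto
  finally show ?thesis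
    by (simp add: blow_up_size_def n(1))
qed

lemma blow_up_size_le:
  assumes "even m" "0 < m"
  shows "blow_up_size m k \<le> exp 1 / 2 * blow_up_rate m k"
proof -
  obtain n where n: "m = 2 * n" "1 \<le> n"
    using assms by (auto elim!: evenE)
  define x where "x = (real k / real (2 * n)) ^ n"
  have pos: "0 < real (2 * n - 1)" "real n \<le> real (2 * n - 1)"
    using n(2) by auto
  have "real (2 * n) / real (2 * n - 1) = 1 + 1 / real (2 * n - 1)"
    using n(2) pos by (simp add: field_simps of_nat_diff)
  also have "\<dots> \<le> exp (1 / real (2 * n - 1))"
    by (rule exp_ge_add_one_self)
  finally have "(real (2 * n) / real (2 * n - 1)) ^ n \<le> exp (1 / real (2 * n - 1)) ^ n"
    by (intro power_mono) auto
  also have "\<dots> = exp (real n / real (2 * n - 1))"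
    by (simp flip: exp_of_nat_mult)
  also have "\<dots> \<le> exp 1"
    using pos by simp
  finally have "x * (real (2 * n) / real (2 * n - 1)) ^ n \<le> x * exp 1"
    by (intro mult_left_mono) (simp_all add: x_def)
  moreover have "x * (real (2 * n) / real (2 * n - 1)) ^ n = (real k / real (2 * n - 1)) ^ n"
    using n(2) by (simp add: x_def flip: power_mult_distrib)
  ultimately have "blow_up_size m k \<le> 4 ^ n / (2 * sqrt (2 * real n)) * (x * exp 1)"
    unfolding blow_up_size_def n(1) using odd_central_binomial_le[OF n(2)] by (intro mult_mono) auto
  also have "\<dots> = exp 1 / 2 * blow_up_rate m k"
    by (simp add: n(1) blow_up_rate_double x_def)
  finally show ?thesis .
qed

lemma sqrt_mult_3_power_le: "sqrt (2 * real n) * 3 ^ n \<le> 3 * 4 ^ n"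
proof -
  have "sqrt (2 * real n) \<le> 3 * (1 + real n * (1 / 3))"
    using arith_geo_mean_sqrt[of 1 "2 * real n"] by simp
  also have "\<dots> \<le> 3 * (1 + 1 / 3) ^ n"
    by (intro mult_left_mono Bernoulli_inequality) auto
  finally show ?thesis
    by (simp add: power_divide field_simps)
qed

lemma sqrt_binomial_le_blow_up_rate:
  assumes "even m" "0 < m"
  shows "sqrt (real (k choose m)) \<le> 3 * blow_up_rate m k"
proof -
  obtain n where n: "m = 2 * n" "1 \<le> n"
    using assms by (auto elim!: evenE)
  define x where "x = (real k / real (2 * n)) ^ n"
  have "real (k choose m) \<le> (exp 1 * real k / real m) ^ m"
    by (rule binomial_le_exp_power)
  also have "\<dots> \<le> (3 * (real k / real m)) ^ m"
    using mult_right_mono[OF exp_le, of "real k / real m"] by (intro power_mono) auto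
  also have "\<dots> = (3 ^ n * x)\<^sup>2"
    by (simp only: n(1) x_def mult.commute[of 2 n] power_mult power_mult_distrib)
  finally have "sqrt (real (k choose m)) \<le> 3 ^ n * x"
    by (intro real_le_lsqrt) (simp_all add: x_def)
  also have "\<dots> \<le> 3 * 4 ^ n / sqrt (2 * real n) * x"
    using sqrt_mult_3_power_le[of n] n(2)
    by (intro mult_right_mono) (simp_all add: x_def field_simps)
  also have "\<dots> = 3 * blow_up_rate m k"
    by (simp add: n(1) blow_up_rate_double x_def)
  finally show ?thesis .
qed

lemma blow_up_size_bigtheta:
  assumes "\<forall>\<^sub>F (m, k) in F. even m \<and> 0 < m"
  shows "(\<lambda>(m, k). blow_up_size m k) \<in> \<Theta>[F](\<lambda>(m, k). blow_up_rate m k)"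
proof (rule bigthetaI'[of "sqrt 2 / 4" "exp 1 / 2"])
  show "\<forall>\<^sub>F p in F.
      sqrt 2 / 4 * norm (case p of (m, k) \<Rightarrow> blow_up_rate m k)
        \<le> norm (case p of (m, k) \<Rightarrow> blow_up_size m k) \<and>
      norm (case p of (m, k) \<Rightarrow> blow_up_size m k)
        \<le> exp 1 / 2 * norm (case p of (m, k) \<Rightarrow> blow_up_rate m k)"
    using assms
  proof eventually_elim
    case (elim p)
    obtain m k where "p = (m, k)"
      by (cases p)
    then show ?case
      using elim blow_up_rate_nonneg[of m k] blow_up_size_ge[of m k] blow_up_size_le[of m k]
      by (simp add: blow_up_size_def)
  qed
qed auto

lemma card_one_out_of: "card (one_out_of m k) = k choose m"
  by (simp add: one_out_of_def n_subsets)

lemma sqrt_card_bigo_blow_up_rate: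
  assumes "\<forall>\<^sub>F (m, k) in F. even m \<and> 0 < m"
  shows "(\<lambda>(m, k). sqrt (real (card (one_out_of m k)))) \<in> O[F](\<lambda>(m, k). blow_up_rate m k)"
proof (rule bigoI[of _ 3])
  show "\<forall>\<^sub>F p in F. norm (case p of (m, k) \<Rightarrow> sqrt (real (card (one_out_of m k))))
      \<le> 3 * norm (case p of (m, k) \<Rightarrow> blow_up_rate m k)"
    using assms
  proof eventually_elim
    case (elim p)
    then show ?case
      using blow_up_rate_nonneg sqrt_binomial_le_blow_up_rate
      by (cases p) (simp add: card_one_out_of)
  qed
qed

lemma blow_up_size_bigomega:
  assumes "\<forall>\<^sub>F (m, k) in F. even m \<and> 0 < m"
  shows "(\<lambda>(m, k). blow_up_size m k) \<in> \<Omega>[F](\<lambda>(m, k). sqrt (real (card (one_out_of m k))))"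
  using landau_omega.big_trans[OF bigthetaD2[OF blow_up_size_bigtheta[OF assms]]]
    sqrt_card_bigo_blow_up_rate[OF assms]
  by (simp add: bigomega_iff_bigo)

section \<open>One-out-of-\<open>m\<close> paging\<close>

lemma odd_binomial_le_det_ratio:
  assumes "odd k"
  shows "ereal (real (k choose ((k + 1) div 2))) \<le> det_ratio k (one_out_of ((k + 1) div 2) k)"
proof -
  have "2 * ((k + 1) div 2) - 1 = k" "1 \<le> (k + 1) div 2"
    using assms by (auto elim!: oddE)
  then show ?thesis
    using binomial_le_det_ratio[of "(k + 1) div 2" k] by simp
qed

lemma two_power_le_det_ratio:
  assumes "1 \<le> k"
  shows "ereal (1 / 4 * (2 ^ k / sqrt (real k))) \<le> det_ratio k (one_out_of ((k + 1) div 2) k)"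
proof -
  let ?n = "(k + 1) div 2"
  have "ereal (1 / 4 * (2 ^ k / sqrt (real k))) \<le> ereal (real ((2 * ?n - 1) choose ?n))"
    using two_power_le_odd_central_binomial by simp
  also have "\<dots> \<le> det_ratio k (one_out_of ?n k)"
    using assms by (intro binomial_le_det_ratio) linarith+
  finally show ?thesis .
qed

lemma blow_up_size_le_det_ratio:
  assumes "(m, k) \<in> admissible"
  shows "ereal (blow_up_size m k) \<le> det_ratio k (one_out_of m k)"
proof -
  obtain n j where n: "m = 2 * n" "1 \<le> n" and j: "odd j" "k = j * (2 * n - 1)" "m < k"
    using assms by (auto simp: admissible_def elim!: evenE)
  have "1 < j"
    using j n by (cases "j = 1") (auto elim!: oddE)
  have "blow_up_size m k = real (((2 * n - 1) choose n) * j ^ n)"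
    using n by (simp add: blow_up_size_def j(2))
  then show ?thesis
    using binomial_mult_power_le_det_ratio[OF j(1) \<open>1 < j\<close> n(2), of k] n(1) j(2) by simp
qed

theorem theorem2:
  shows
    "((\<forall>k. odd k \<longrightarrow>
         ereal (real (k choose ((k + 1) div 2))) \<le> det_ratio k (one_out_of ((k + 1) div 2) k)) \<and>
      (\<lambda>k. real (k choose ((k + 1) div 2))) \<in> \<Omega>[principal {k. odd k}](\<lambda>k. 2 ^ k / sqrt (real k)) \<and>
      (\<exists>c>0. \<forall>k\<ge>1.
         ereal (c * (2 ^ k / sqrt (real k))) \<le> det_ratio k (one_out_of ((k + 1) div 2) k)))
     \<and>
     ((\<forall>(m, k)\<in>admissible.
         ereal (real ((m - 1) choose (m div 2)) * (real k / real (m - 1)) ^ (m div 2))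
           \<le> det_ratio k (one_out_of m k)) \<and>
      (\<lambda>(m, k). real ((m - 1) choose (m div 2)) * (real k / real (m - 1)) ^ (m div 2))
         \<in> \<Theta>[principal admissible](\<lambda>(m, k). (4 * real k / real m) ^ (m div 2) / sqrt (real m)) \<and>
      (\<lambda>(m, k). real ((m - 1) choose (m div 2)) * (real k / real (m - 1)) ^ (m div 2))
         \<in> \<Omega>[principal admissible](\<lambda>(m, k). sqrt (real (card (one_out_of m k)))))"
    (is "(?binomial \<and> ?binomial_asymp \<and> ?two_power) \<and> (?blow_up \<and> ?blow_up_theta \<and> ?blow_up_omega)")
proof (intro conjI)
  show ?binomial
    using odd_binomial_le_det_ratio by blast
  show ?binomial_asymp
    by (rule half_binomial_bigomega)
  show ?two_power
    using two_power_le_det_ratio by (intro exI[of _ "1 / 4"]) simp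
  show ?blow_up
    using blow_up_size_le_det_ratio unfolding blow_up_size_def by blast
  have "\<forall>\<^sub>F (m, k) in principal admissible. even m \<and> 0 < m"
    by (auto simp: eventually_principal admissible_def)
  then show ?blow_up_theta ?blow_up_omega
    using blow_up_size_bigtheta blow_up_size_bigomega
    unfolding blow_up_size_def blow_up_rate_def by blast+
qed

end
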